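(* Let $E$ be a finite-dimensional real vector space, $Q\subset E$ nonempty, convex and compact, and $h:Q\to\mathbb{R}$ concave and differentiable on $Q$, with finite curvature constant $C_{h,Q}$. Let $C_1>0$ be a given number (an estimate of $C_{h,Q}$). Run the Frank-Wolfe method (without a pre-start step) from an initial point $\lambda_1\in Q$, suppose $B_1>h(\lambda_1)$, and use the step-sizes $$\bar\alpha_i=\frac{2}{\frac{2C_1}{B_1-h(\lambda_1)}+i+1}\qquad\text{for } i\ge1.$$ Then for all $k\ge1$: $$B_k-h(\lambda_{k+1})\le\frac{2\max\{C_1,C_{h,Q}\}}{\frac{2C_1}{B_1-h(\lambda_1)}+k}.$$
   Context: Notation: $E^*$ is the dual space of $E$, $s^T\lambda$ is the evaluation of $s\in E^*$ at $\lambda\in E$, $\nabla h(\lambda)\in E^*$, and $h^*=\max_{\lambda\in Q}h(\lambda)$. Curvature constant: $C_{h,Q}$ is the minimal $C$ such that $h(\lambda+\alpha(\bar\lambda-\lambda))\ge h(\lambda)+\nabla h(\lambda)^T(\alpha(\bar\lambda-\lambda))-\frac12 C\alpha^2$ for all $\lambda,\bar\lambda\in Q$ and all $\alpha\in[0,1]$ (assumed finite). Frank-Wolfe method: start at $\lambda_1\in Q$ with an upper bound $B_0\ge h^*$ (possibly $+\infty$). At iteration $k\ge1$, choose $\tilde\lambda_k\in\arg\max_{\lambda\in Q}\{h(\lambda_k)+\nabla h(\lambda_k)^T(\lambda-\lambda_k)\}$; set $B^w_k=h(\lambda_k)+\nabla h(\lambda_k)^T(\tilde\lambda_k-\lambda_k)$;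 set $B_k=\min\{B_{k-1},B^w_k,B^o_k\}$, where $B^o_k\ge h^*$ is any other (optional) upper bound on $h^*$ (omitted, or $+\infty$, if not computed); then set $\lambda_{k+1}=\lambda_k+\bar\alpha_k(\tilde\lambda_k-\lambda_k)$. (Thus $B_1$ is available before the step-size $\bar\alpha_1$ is needed.) *)

theory Defs
  imports "HOL-Analysis.Analysis"
begin

text \<open>
  The dual space of \<open>E = 'a\<close> is \<open>'a \<Rightarrow>\<^sub>L real\<close>; in finite dimension every linear functional is
  bounded. A function on \<open>Q\<close> is a total function of which only the values on \<open>Q\<close> are used.
\<close>

text \<open>
  Differentiability is relative to \<open>Q\<close>. If \<open>Q\<close> is not full-dimensional, the gradient is not
  unique, but its values on the directions \<open>y - x\<close> with \<open>x, y \<in> Q\<close>, the only ones used below,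
  are determined by \<open>h\<close> on the convex set \<open>Q\<close>.
\<close>

definition is_gradient_on ::
    "'a::real_normed_vector set \<Rightarrow> ('a \<Rightarrow> real) \<Rightarrow> ('a \<Rightarrow> 'a \<Rightarrow>\<^sub>L real) \<Rightarrow> bool" where
  "is_gradient_on Q h grad \<longleftrightarrow>
     (\<forall>x\<in>Q. (h has_derivative blinfun_apply (grad x)) (at x within Q))"

definition linearization ::
    "('a::real_normed_vector \<Rightarrow> real) \<Rightarrow> ('a \<Rightarrow> 'a \<Rightarrow>\<^sub>L real) \<Rightarrow> 'a \<Rightarrow> 'a \<Rightarrow> real" where
  "linearization h grad x y = h x + blinfun_apply (grad x) (y - x)"

definition max_value :: "'a set \<Rightarrow> ('a \<Rightarrow> real) \<Rightarrow> real" where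
  "max_value Q h = (GREATEST v. v \<in> h ` Q)"

definition curvature_bound ::
    "'a::real_normed_vector set \<Rightarrow> ('a \<Rightarrow> real) \<Rightarrow> ('a \<Rightarrow> 'a \<Rightarrow>\<^sub>L real) \<Rightarrow> real \<Rightarrow> bool" where
  "curvature_bound Q h grad C \<longleftrightarrow>
     (\<forall>x\<in>Q. \<forall>y\<in>Q. \<forall>\<alpha>\<in>{0..1}.
        h (x + \<alpha> *\<^sub>R (y - x))
          \<ge> h x + blinfun_apply (grad x) (\<alpha> *\<^sub>R (y - x)) - 1/2 * C * \<alpha>\<^sup>2)"

definition finite_curvature ::
    "'a::real_normed_vector set \<Rightarrow> ('a \<Rightarrow> real) \<Rightarrow> ('a \<Rightarrow> 'a \<Rightarrow>\<^sub>L real) \<Rightarrow> bool" where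
  "finite_curvature Q h grad \<longleftrightarrow> (\<exists>C. curvature_bound Q h grad C)"

text \<open>Meaningful for \<open>Q \<noteq> {}\<close> and \<open>finite_curvature Q h grad\<close>; the least element then exists.\<close>

definition curvature_const ::
    "'a::real_normed_vector set \<Rightarrow> ('a \<Rightarrow> real) \<Rightarrow> ('a \<Rightarrow> 'a \<Rightarrow>\<^sub>L real) \<Rightarrow> real" where
  "curvature_const Q h grad = (LEAST C. curvature_bound Q h grad C)"

text \<open>
  A run of the Frank-Wolfe method with iterates \<open>x k\<close>, linear-subproblem solutions \<open>xt k\<close>,
  upper bounds \<open>B k\<close>, optional extra upper bounds \<open>Bo k\<close> (\<open>\<infinity>\<close> where none is computed) and
  step-sizes \<open>a k\<close>. Iterations are numbered from 1, so \<open>x 0\<close>, \<open>xt 0\<close>, \<open>Bo 0\<close>, \<open>a 0\<close> play no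
  role; \<open>B 0\<close> is the initial bound, possibly \<open>\<infinity>\<close>.
\<close>

definition frank_wolfe_run ::
    "'a::real_normed_vector set \<Rightarrow> ('a \<Rightarrow> real) \<Rightarrow> ('a \<Rightarrow> 'a \<Rightarrow>\<^sub>L real) \<Rightarrow>
     (nat \<Rightarrow> 'a) \<Rightarrow> (nat \<Rightarrow> 'a) \<Rightarrow> (nat \<Rightarrow> ereal) \<Rightarrow> (nat \<Rightarrow> ereal) \<Rightarrow> (nat \<Rightarrow> real) \<Rightarrow> bool" where
  "frank_wolfe_run Q h grad x xt B Bo a \<longleftrightarrow>
     x 1 \<in> Q \<and> ereal (max_value Q h) \<le> B 0 \<and>
     (\<forall>k\<ge>1.
        is_arg_max (linearization h grad (x k)) (\<lambda>y. y \<in> Q) (xt k) \<and>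
        ereal (max_value Q h) \<le> Bo k \<and>
        B k = min (B (k - 1)) (min (ereal (linearization h grad (x k) (xt k))) (Bo k)) \<and>
        x (k + 1) = x k + a k *\<^sub>R (xt k - x k))"

end

theory Submission
  imports Defs
begin

text \<open>
  The curvature inequality along the step towards \<open>xt k\<close> shows that the bound gap
  \<open>g\<^sub>k = B k - h (x (k + 1))\<close> obeys \<open>g\<^sub>k \<le> (1 - a k) * g\<^sub>k\<^sub>-\<^sub>1 + M / 2 * (a k)\<^sup>2\<close> with
  \<open>M = max C1 C\<close>, because the bounds \<open>B k\<close> decrease. With \<open>a k = 2 / (c + k + 1)\<close> this recursion
  preserves \<open>g\<^sub>k \<le> 2 * M / (c + k)\<close>, and the choice \<open>c = 2 * C1 / (B 1 - h (x 1))\<close> makes the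
  estimate hold at \<open>k = 0\<close>, with \<open>B 1 - h (x 1)\<close> in the role of \<open>g\<^sub>0\<close>.
\<close>

text \<open>With equal endpoints and \<alpha> = 1 only the term -C/2 survives in the curvature
  inequality.\<close>

lemma curvature_bound_nonneg:
  assumes "Q \<noteq> {}" and "curvature_bound Q h grad C"
  shows "0 \<le> C"
proof -
  obtain z where "z \<in> Q" using assms(1) by blast
  then have "h (z + 1 *\<^sub>R (z - z)) \<ge> h z + blinfun_apply (grad z) (1 *\<^sub>R (z - z)) - 1/2 * C * 1\<^sup>2"
    using assms(2) unfolding curvature_bound_def by (auto dest!: bspec[of _ _ z] bspec[of _ _ 1])
  then show ?thesis by (simp add: blinfun.zero_right)
qed

text \<open>\<open>LEAST\<close> over the reals needs an attained infimum. The admissible constants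
  form an intersection of closed sets, nonempty and bounded below by 0, so their infimum is
  admissible.\<close>

lemma curvature_bound_curvature_const:
  assumes "Q \<noteq> {}" and "finite_curvature Q h grad"
  shows "curvature_bound Q h grad (curvature_const Q h grad)"
proof -
  define S where "S = {C. curvature_bound Q h grad C}"
  have ne: "S \<noteq> {}"
    using assms(2) by (auto simp: S_def finite_curvature_def)
  have bdd: "bdd_below S"
    using curvature_bound_nonneg[OF assms(1)] by (auto simp: S_def intro!: bdd_belowI[of _ 0])
  have "S = (\<Inter>x\<in>Q. \<Inter>y\<in>Q. \<Inter>\<alpha>\<in>{0..1}. {C. h x + blinfun_apply (grad x) (\<alpha> *\<^sub>R (y - x))
      - 1/2 * C * \<alpha>\<^sup>2 \<le> h (x + \<alpha> *\<^sub>R (y - x))})"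
    by (auto simp: S_def curvature_bound_def)
  moreover have "closed {C. u - 1/2 * C * \<alpha>\<^sup>2 \<le> v}" for u v \<alpha> :: real
    by (intro closed_Collect_le continuous_intros)
  ultimately have "closed S" by (simp add: closed_INT)
  then have "Inf S \<in> S" using ne bdd closed_contains_Inf by blast
  moreover have "curvature_const Q h grad = Inf S"
    unfolding curvature_const_def
    using calculation bdd by (intro Least_equality) (auto simp: S_def intro: cInf_lower)
  ultimately show ?thesis by (simp add: S_def)
qed

lemma curvature_bound_mono:
  assumes "curvature_bound Q h grad C" and "C \<le> D"
  shows "curvature_bound Q h grad D"
proof -
  have "1/2 * C * \<alpha>\<^sup>2 \<le> 1/2 * D * \<alpha>\<^sup>2" for \<alpha> :: real
    using assms(2) by (simp add: mult_right_mono)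
  then have "u - 1/2 * D * \<alpha>\<^sup>2 \<le> v" if "u - 1/2 * C * \<alpha>\<^sup>2 \<le> v" for u v \<alpha> :: real
    using that by (meson diff_left_mono order_trans)
  then show ?thesis
    using assms(1) unfolding curvature_bound_def by blast
qed

text \<open>The linear gain along the step is \<alpha> times the gap between linearization and
  value, so any \<open>b\<close> below the linearization may replace it. Later \<open>b\<close> is
  the current upper bound.\<close>

lemma curvature_bound_step:
  assumes "curvature_bound Q h grad M" and "x \<in> Q" "y \<in> Q" and "\<alpha> \<in> {0..1}"
    and "b \<le> linearization h grad x y"
  shows "b - h (x + \<alpha> *\<^sub>R (y - x)) \<le> (1 - \<alpha>) * (b - h x) + M / 2 * \<alpha>\<^sup>2"
proof -
  have "h (x + \<alpha> *\<^sub>R (y - x)) \<ge> h x + \<alpha> * (linearization h grad x y - h x) - M / 2 * \<alpha>\<^sup>2"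
    using assms(1-4) by (auto simp: curvature_bound_def linearization_def blinfun.scaleR_right)
  moreover have "\<alpha> * (b - h x) \<le> \<alpha> * (linearization h grad x y - h x)"
    using assms(4,5) by (simp add: mult_left_mono)
  ultimately show ?thesis by (simp add: algebra_simps)
qed

text \<open>Here \<open>s\<close> stands for \<open>c + k\<close>, so 2/(s+1) is the step-size and
  the bound on \<open>g\<close> is the rate one index earlier. After cancelling s - 1, everything
  rests on s(s+2) \<le> (s+1)^2.\<close>

lemma gap_recursion_rate:
  fixes M s g :: real
  assumes "0 \<le> M" "1 < s" and g: "g \<le> 2 * M / (s - 1)"
  shows "(1 - 2 / (s + 1)) * g + M / 2 * (2 / (s + 1))\<^sup>2 \<le> 2 * M / s"
proof -
  have "(1 - 2 / (s + 1)) * g \<le> (1 - 2 / (s + 1)) * (2 * M / (s - 1))"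
    using assms by (intro mult_left_mono) (auto simp: field_simps)
  moreover have "1 - 2 / (s + 1) = (s - 1) / (s + 1)"
    using assms(2) by (simp add: field_simps)
  then have "(1 - 2 / (s + 1)) * (2 * M / (s - 1)) = 2 * M * (1 / (s + 1))"
    using assms(2) by simp
  moreover have "M / 2 * (2 / (s + 1))\<^sup>2 = 2 * M * (1 / (s + 1)\<^sup>2)"
    by (simp add: power_divide)
  ultimately have "(1 - 2 / (s + 1)) * g + M / 2 * (2 / (s + 1))\<^sup>2
      \<le> 2 * M * (1 / (s + 1) + 1 / (s + 1)\<^sup>2)"
    by (simp add: distrib_left)
  also have "1 / (s + 1) + 1 / (s + 1)\<^sup>2 = (s + 2) / (s + 1)\<^sup>2"
    using assms(2) by (simp add: divide_simps power2_eq_square)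
  also have "(s + 2) / (s + 1)\<^sup>2 \<le> 1 / s"
  proof -
    have "s * (s + 2) \<le> (s + 1)\<^sup>2"
      by (simp add: power2_eq_square algebra_simps)
    then show ?thesis
      using assms(2) by (simp add: pos_divide_le_eq pos_le_divide_eq mult.commute)
  qed
  finally show ?thesis using assms(1) by (simp add: mult_left_mono)
qed

text \<open>Every entry of the minimum lies above a real number, and from k = 1 on one entry, the
  linearization, is itself real, even if \<open>B 0\<close> is infinite.\<close>

lemma frank_wolfe_run_bound_finite:
  assumes "frank_wolfe_run Q h grad x xt B Bo a" and "k \<ge> 1"
  shows "\<bar>B k\<bar> \<noteq> \<infinity>"
proof -
  have run: "ereal (max_value Q h) \<le> Bo k"
      "B k = min (B (k - 1)) (min (ereal (linearization h grad (x k) (xt k))) (Bo k))"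
    if "k \<ge> 1" for k
    using assms(1) that unfolding frank_wolfe_run_def by blast+
  have "B k \<noteq> - \<infinity>" for k
  proof (induction k)
    case 0
    have "ereal (max_value Q h) \<le> B 0"
      using assms(1) unfolding frank_wolfe_run_def by blast
    then show ?case by auto
  next
    case (Suc k)
    then show ?case using run[of "Suc k"] by (auto simp: min_def)
  qed
  moreover have "B k \<noteq> \<infinity>"
    using run(2)[OF assms(2)] by (auto simp: min_def)
  ultimately show ?thesis by auto
qed

lemma frank_wolfe_run_in_domain:
  assumes "frank_wolfe_run Q h grad x xt B Bo a" and "convex Q"
    and "\<And>i. i \<ge> 1 \<Longrightarrow> a i \<in> {0..1}" and "k \<ge> 1"
  shows "x k \<in> Q"
  using assms(4)
proof (induction k rule: dec_induct)
  case base
  then show ?case using assms(1) by (simp add: frank_wolfe_run_def)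
next
  case (step k)
  have "xt k \<in> Q" "x (Suc k) = (1 - a k) *\<^sub>R x k + a k *\<^sub>R xt k"
    using assms(1) step.hyps
    by (auto simp: frank_wolfe_run_def is_arg_max_def algebra_simps)
  then show ?case
    using step assms(3)[of k] by (auto intro!: convexD[OF assms(2)])
qed

theorem mainTheorem7:
  fixes Q :: "'a::real_normed_vector set"
    and h :: "'a \<Rightarrow> real"
    and grad :: "'a \<Rightarrow> 'a \<Rightarrow>\<^sub>L real"
    and C1 :: real
    and x xt :: "nat \<Rightarrow> 'a"
    and B Bo :: "nat \<Rightarrow> ereal"
    and a :: "nat \<Rightarrow> real"
  assumes fin_dim: "\<exists>S :: 'a set. finite S \<and> span S = UNIV"
    and Q: "Q \<noteq> {}" "convex Q" "compact Q"
    and concave: "concave_on Q h"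
    and grad: "is_gradient_on Q h grad"
    and curv: "finite_curvature Q h grad"
    and C1: "C1 > 0"
    and run: "frank_wolfe_run Q h grad x xt B Bo a"
    and gap: "B 1 > ereal (h (x 1))"
    and steps: "\<And>i. i \<ge> 1 \<Longrightarrow>
      a i = 2 / (2 * C1 / (real_of_ereal (B 1) - h (x 1)) + real i + 1)"
  shows "\<forall>k\<ge>1. B k - ereal (h (x (k + 1)))
    \<le> ereal (2 * max C1 (curvature_const Q h grad)
               / (2 * C1 / (real_of_ereal (B 1) - h (x 1)) + real k))"
proof -
  define b where "b = (\<lambda>k. real_of_ereal (B k))"
  define c where "c = 2 * C1 / (b 1 - h (x 1))"
  define M where "M = max C1 (curvature_const Q h grad)"
  have B: "B k = ereal (b k)" if "k \<ge> 1" for k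
    using frank_wolfe_run_bound_finite[OF run that] by (simp add: b_def ereal_real)
  have gap1: "b 1 > h (x 1)"
    using gap B[of 1] by simp
  have M: "C1 \<le> M" "M > 0"
    using C1 by (auto simp: M_def)
  have c: "c > 0"
    using C1 gap1 by (simp add: c_def)
  have a: "a k = 2 / (c + k + 1)" if "k \<ge> 1" for k
    using steps[OF that] by (simp add: c_def b_def)
  have a01: "a k \<in> {0..1}" if "k \<ge> 1" for k
    using c that by (simp add: a[OF that])
  have curvM: "curvature_bound Q h grad M"
    using curvature_bound_mono[OF curvature_bound_curvature_const[OF Q(1) curv]]
    by (simp add: M_def)
  have xQ: "x k \<in> Q" if "k \<ge> 1" for k
    using frank_wolfe_run_in_domain[OF run Q(2) a01 that] .
  have bw: "b k \<le> linearization h grad (x k) (xt k)" if "k \<ge> 1" for k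
  proof -
    have "B k \<le> ereal (linearization h grad (x k) (xt k))"
      using run that by (simp add: frank_wolfe_run_def min.coboundedI2)
    then show ?thesis by (simp add: B[OF that])
  qed
  \<comment> \<open>The premise pairs \<open>b k\<close> with \<open>x k\<close> instead of using
    \<open>b (k - 1)\<close>: at k = 1 the previous bound \<open>B 0\<close> may be
    infinite.\<close>
  have gap_step: "b k - h (x (k + 1)) \<le> 2 * M / (c + k)"
    if k: "k \<ge> 1" and g: "b k - h (x k) \<le> 2 * M / (c + k - 1)" for k
  proof -
    have "xt k \<in> Q" "x (k + 1) = x k + a k *\<^sub>R (xt k - x k)"
      using run k by (auto simp: frank_wolfe_run_def is_arg_max_def)
    then have "b k - h (x (k + 1)) \<le> (1 - a k) * (b k - h (x k)) + M / 2 * (a k)\<^sup>2"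
      using curvature_bound_step[OF curvM xQ[OF k] _ a01[OF k] bw[OF k]] by simp
    also have "\<dots> \<le> 2 * M / (c + k)"
      using gap_recursion_rate[of M "c + k" "b k - h (x k)"] M c k g by (simp add: a[OF k])
    finally show ?thesis .
  qed
  have main: "b k - h (x (k + 1)) \<le> 2 * M / (c + k)" if "k \<ge> 1" for k
    using that
  proof (induction k rule: dec_induct)
    case base
    \<comment> \<open>This is the definition of \<open>c\<close> solved for the initial gap;
      \<open>C1\<close> \<le> \<open>M\<close> then gives the premise of \<open>gap_step\<close> at
      k = 1.\<close>
    have "b 1 - h (x 1) = 2 * C1 / c"
      using C1 gap1 by (simp add: c_def)
    also have "\<dots> \<le> 2 * M / c"
      using M c by (simp add: divide_right_mono)
    finally show ?case using gap_step[of 1] by simp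
  next
    case (step k)
    \<comment> \<open>Monotonicity carries the induction hypothesis on \<open>b k\<close> over to
      \<open>b (Suc k)\<close> at the same iterate, as \<open>gap_step\<close> requires.\<close>
    have "B (Suc k) \<le> B k"
      using run by (simp add: frank_wolfe_run_def)
    then have "b (Suc k) \<le> b k"
      using step.hyps by (simp add: B)
    then show ?case
      using step.IH gap_step[of "Suc k"] by simp
  qed
  show ?thesis
    using main unfolding M_def c_def by (simp add: B)
qed

end
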